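(* Let $q, N_x, N_s, N_p$ be positive integers with $q\le N_x$ and $q\le N_s$. Let $\Phi,\Phi_1,\dots,\Phi_{N_p}\in\mathbb{R}^{N_x\times q}$ and $\Lambda,\Lambda_1,\dots,\Lambda_{N_p}\in\mathbb{R}^{N_s\times q}$ be matrices with orthonormal columns, such that $\mathrm{dist}_{\mathcal G}(\Phi,\Phi_i)\neq 0$ and $\mathrm{dist}_{\mathcal G}(\Lambda,\Lambda_i)\neq 0$ for all $i$. Let $m>1$ and $l\ge 1$ be real numbers, and define the weights $$\omega_i=\frac{\mathrm{dist}_{\mathcal G}(\Phi,\Phi_i)^{-m}}{\sum_{k=1}^{N_p}\mathrm{dist}_{\mathcal G}(\Phi,\Phi_k)^{-m}},\qquad \kappa_i=\frac{\mathrm{dist}_{\mathcal G}(\Lambda,\Lambda_i)^{-l}}{\sum_{k=1}^{N_p}\mathrm{dist}_{\mathcal G}(\Lambda,\Lambda_k)^{-l}},\qquad i=1,\dots,N_p.$$ Let $$\Phi^T\sum_{i=1}^{N_p}\omega_i\Phi_i=\xi\,\Theta\,\eta^T,\qquad \Lambda^T\sum_{i=1}^{N_p}\kappa_i\Lambda_i=\zeta\,\delta\,\rho^T$$ be singular value decompositions, where $\xi,\eta,\zeta,\rho\in\mathcal{O}(q)$ and $\Theta,\delta$ are diagonal $q\times q$ matrices with nonnegative entries. Then $Q_x=\xi\eta^T$ is a solution of the constrained minimization problem $$\min_{Q\in\mathcal{O}(q)}\ \sum_{i=1}^{N_p}\omega_i\,\|\Phi Q-\Phi_i\|_F^2,$$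 and $Q_t=\zeta\rho^T$ is a solution of the constrained minimization problem $$\min_{Q\in\mathcal{O}(q)}\ \sum_{i=1}^{N_p}\kappa_i\,\|\Lambda Q-\Lambda_i\|_F^2.$$
   Context: $\mathcal{O}(q)$ denotes the group of real orthogonal $q\times q$ matrices and $\|\cdot\|_F$ the Frobenius norm. A matrix $\Phi\in\mathbb{R}^{N\times q}$ with $\Phi^T\Phi=I_q$ represents the $q$-dimensional subspace of $\mathbb{R}^N$ spanned by its columns, viewed as a point of the Grassmann manifold $\mathcal{G}(q,N)$. For two such matrices $\Phi,\Psi\in\mathbb{R}^{N\times q}$, the Grassmann geodesic distance between the subspaces they represent is $$\mathrm{dist}_{\mathcal G}(\Phi,\Psi)=\sqrt{\sum_{i=1}^{q}\arccos^2(\sigma_i)},$$ where $\sigma_1,\dots,\sigma_q$ are the singular values of $\Phi^T\Psi$. (In the intended use, $\Phi_i$ and $\Lambda_i$ are spatial and temporal bases at sampled parameter values, and $\Phi$ and $\Lambda$ are interpolated bases at a new parameter value.) *)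

theory Defs
  imports "HOL-Analysis.Analysis" "HOL-Computational_Algebra.Polynomial"
begin

(* A matrix in R^(N x q) is an element of real^'q^'n (type of the row index last),
   with CARD('n) = N and CARD('q) = q. *)

definition orthonormal_columns :: "real^'q^'n \<Rightarrow> bool" where
  "orthonormal_columns A \<longleftrightarrow> transpose A ** A = mat 1"

definition frobenius_norm :: "real^'q^'n \<Rightarrow> real" where
  "frobenius_norm A = sqrt (\<Sum>i\<in>UNIV. \<Sum>j\<in>UNIV. (A $ i $ j)\<^sup>2)"

lemma frobenius_norm_eq_norm: "frobenius_norm A = norm A"
  by (simp add: frobenius_norm_def norm_vec_def L2_set_def real_sqrt_pow2 sum_nonneg)

definition charpoly :: "real^'n^'n \<Rightarrow> real poly" where
  "charpoly A = det (mat [:0, 1:] - (\<chi> i j. [:A $ i $ j:]))"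

(* The square roots of the eigenvalues of A^T A, counted with multiplicity. *)
definition singular_values :: "real^'n^'n \<Rightarrow> real multiset" where
  "singular_values A = image_mset sqrt (proots (charpoly (transpose A ** A)))"

definition grassmann_dist :: "real^'q^'n \<Rightarrow> real^'q^'n \<Rightarrow> real" where
  "grassmann_dist \<Phi> \<Psi> =
     sqrt (\<Sum>\<sigma>\<in>#singular_values (transpose \<Phi> ** \<Psi>). (arccos \<sigma>)\<^sup>2)"

definition is_svd :: "real^'n^'n \<Rightarrow> real^'n^'n \<Rightarrow> real^'n^'n \<Rightarrow> real^'n^'n \<Rightarrow> bool" where
  "is_svd A U S V \<longleftrightarrow>
     orthogonal_matrix U \<and> orthogonal_matrix V \<and>
     (\<forall>i j. i \<noteq> j \<longrightarrow> S $ i $ j = 0) \<and> (\<forall>i. 0 \<le> S $ i $ i) \<and>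
     A = U ** S ** transpose V"

lemma charpoly_orthogonal_similar:
  fixes V B :: "real^'n^'n"
  assumes "orthogonal_matrix V"
  shows "charpoly (V ** B ** transpose V) = charpoly B"
proof -
  define c where "c = (\<lambda>M::real^'n^'n. (\<chi> i j. [:M $ i $ j:]) :: real poly^'n^'n)"
  have c_mult: "c (M ** N) = c M ** c N" for M N
  proof -
    have "[:\<Sum>k\<in>K. f k:] = (\<Sum>k\<in>K. [:f k:])" for f :: "'n \<Rightarrow> real" and K
      by (induction K rule: infinite_finite_induct) (simp_all, metis add.right_neutral add_pCons)
    then show ?thesis
      by (simp add: c_def matrix_matrix_mult_def vec_eq_iff mult.commute)
  qed
  have "c (mat 1) = mat 1"
    by (auto simp: c_def mat_def vec_eq_iff)
  then have inv: "c V ** c (transpose V) = mat 1"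
    using assms by (simp flip: c_mult add: orthogonal_matrix_def)
  have X: "M ** mat [:0, 1:] = mat [:0, 1:] ** M" for M :: "real poly^'n^'n"
    by (simp add: matrix_matrix_mult_def mat_def vec_eq_iff if_distrib if_distribR
        sum.delta sum.delta' cong: if_cong)
  have diff: "P ** (M - N) = P ** M - P ** N" "(M - N) ** P = M ** P - N ** P"
    for P M N :: "real poly^'n^'n"
    by (simp_all add: matrix_matrix_mult_def vec_eq_iff sum_subtractf ring_distribs)
  have "mat [:0, 1:] - c (V ** B ** transpose V)
      = c V ** (mat [:0, 1:] - c B) ** c (transpose V)"
    unfolding diff c_mult X by (simp add: inv flip: matrix_mul_assoc)
  then have "charpoly (V ** B ** transpose V)
      = det (c V) * det (mat [:0, 1:] - c B) * det (c (transpose V))"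
    by (simp add: charpoly_def c_def det_mul)
  also have "\<dots> = det (c V ** c (transpose V)) * det (mat [:0, 1:] - c B)"
    by (simp add: det_mul)
  finally show ?thesis
    unfolding inv by (simp add: charpoly_def c_def)
qed

lemma singular_values_of_svd:
  fixes A U S V :: "real^'n^'n"
  assumes "is_svd A U S V"
  shows "singular_values A = image_mset (\<lambda>i. S $ i $ i) (mset_set UNIV)"
proof -
  from assms have U: "transpose U ** U = mat 1" and V: "orthogonal_matrix V"
    and S: "\<And>i j. i \<noteq> j \<Longrightarrow> S $ i $ j = 0" "\<And>i. 0 \<le> S $ i $ i"
    and A: "A = U ** S ** transpose V"
    by (auto simp: is_svd_def orthogonal_matrix_def)
  have "transpose A ** A = V ** transpose S ** (transpose U ** U) ** S ** transpose V"
    by (simp add: A matrix_transpose_mul matrix_mul_assoc)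
  also have "\<dots> = V ** (transpose S ** S) ** transpose V"
    by (simp add: U matrix_mul_assoc)
  finally have "charpoly (transpose A ** A) = charpoly (transpose S ** S)"
    using charpoly_orthogonal_similar[OF V] by simp
  also have "\<dots> = (\<Prod>i\<in>UNIV. [:- (S $ i $ i)\<^sup>2, 1:])"
  proof -
    have *: "(transpose S ** S) $ i $ j = (if i = j then (S $ i $ i)\<^sup>2 else 0)" for i j
    proof -
      have "S $ k $ i * S $ k $ j = (if k = i then (if i = j then (S $ i $ i)\<^sup>2 else 0) else 0)" for k
        using S(1) by (auto simp: power2_eq_square)
      then show ?thesis
        by (simp add: matrix_matrix_mult_def transpose_def)
    qed
    show ?thesis
      unfolding charpoly_def by (subst det_diagonal) (simp_all add: * mat_def)
  qed
  also have "proots \<dots> = image_mset (\<lambda>i. (S $ i $ i)\<^sup>2) (mset_set UNIV)"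
  proof -
    have "proots (\<Prod>i\<in>K. [:- f i, 1:]) = image_mset f (mset_set K)"
      if "finite K" for f :: "'n \<Rightarrow> real" and K
      using that
      by (induction K rule: finite_induct) (simp_all add: proots_mult del: mult_pCons_left)
    then show ?thesis by simp
  qed
  finally show ?thesis
    using S(2) by (simp add: singular_values_def multiset.map_comp o_def)
qed

end

theory Submission
  imports Defs
begin

text \<open>Since \<open>\<parallel>\<Phi>Q\<parallel>\<close> does not depend on the orthogonal matrix \<open>Q\<close>,
  expanding the squares shows that minimizing the weighted sum amounts to maximizing the Frobenius inner product of \<open>Q\<close> with
  \<open>\<Phi>\<^sup>T \<Sum>\<^sub>i \<omega>\<^sub>i \<Phi>\<^sub>i = \<xi> \<Theta> \<eta>\<^sup>T\<close>. That inner product equals the one of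
  \<open>\<xi>\<^sup>T Q \<eta>\<close> with \<open>\<Theta>\<close>, and the diagonal entries of an orthogonal matrix are at most 1, with
  equality throughout at the identity.\<close>

text \<open>On nested vectors \<open>\<bullet>\<close> is the Frobenius inner product, for which the
  adjoint of left multiplication is multiplication by the transpose: both sides are the same triple
  sum in a different order.\<close>

lemma inner_matrix_mult_left:
  fixes M :: "real^'k^'n" and A :: "real^'m^'k" and B :: "real^'m^'n"
  shows "(M ** A) \<bullet> B = A \<bullet> (transpose M ** B)"
proof -
  have "(M ** A) \<bullet> B = (\<Sum>i\<in>UNIV. \<Sum>j\<in>UNIV. \<Sum>k\<in>UNIV. M $ i $ k * A $ k $ j * B $ i $ j)"
    by (simp add: inner_vec_def matrix_matrix_mult_def sum_distrib_right)
  also have "\<dots> = (\<Sum>i\<in>UNIV. \<Sum>k\<in>UNIV. \<Sum>j\<in>UNIV. M $ i $ k * A $ k $ j * B $ i $ j)"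
    by (intro sum.cong refl sum.swap)
  also have "\<dots> = (\<Sum>k\<in>UNIV. \<Sum>i\<in>UNIV. \<Sum>j\<in>UNIV. M $ i $ k * A $ k $ j * B $ i $ j)"
    by (rule sum.swap)
  also have "\<dots> = (\<Sum>k\<in>UNIV. \<Sum>j\<in>UNIV. \<Sum>i\<in>UNIV. M $ i $ k * A $ k $ j * B $ i $ j)"
    by (intro sum.cong refl sum.swap)
  also have "\<dots> = A \<bullet> (transpose M ** B)"
    by (simp add: inner_vec_def matrix_matrix_mult_def transpose_def sum_distrib_left mult_ac)
  finally show ?thesis .
qed

lemma inner_transpose:
  fixes A B :: "real^'m^'n"
  shows "transpose A \<bullet> transpose B = A \<bullet> B"
  unfolding inner_vec_def transpose_def by (simp, rule sum.swap)

lemma inner_matrix_mult_right: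
  fixes A :: "real^'k^'n" and M :: "real^'m^'k" and B :: "real^'m^'n"
  shows "(A ** M) \<bullet> B = A \<bullet> (B ** transpose M)"
  using inner_matrix_mult_left[of "transpose M" "transpose A" "transpose B"]
    inner_transpose[of "A ** M" B] inner_transpose[of A "B ** transpose M"]
  by (simp add: matrix_transpose_mul)

text \<open>Moving \<open>\<Phi>\<close> across the inner product produces the Gram matrix
  \<open>transpose \<Phi> ** \<Phi>\<close>, which is the identity.\<close>

lemma norm_orthonormal_columns_mult:
  fixes \<Phi> :: "real^'q^'n" and Q :: "real^'m^'q"
  assumes "orthonormal_columns \<Phi>"
  shows "norm (\<Phi> ** Q) = norm Q"
proof -
  have "(\<Phi> ** Q) \<bullet> (\<Phi> ** Q) = Q \<bullet> ((transpose \<Phi> ** \<Phi>) ** Q)"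
    by (simp add: inner_matrix_mult_left matrix_mul_assoc)
  then show ?thesis
    using assms by (simp add: orthonormal_columns_def norm_eq_sqrt_inner)
qed

lemma norm_orthogonal_matrix_mat_1:
  fixes Q :: "real^'n^'n"
  assumes "orthogonal_matrix Q"
  shows "norm Q = norm (mat 1 :: real^'n^'n)"
  using norm_orthonormal_columns_mult[of Q "mat 1 :: real^'n^'n"] assms
  by (simp add: orthonormal_columns_def orthogonal_matrix)

text \<open>Each row is a unit vector, and no component exceeds the norm.\<close>

lemma orthogonal_matrix_entry_le_1:
  fixes W :: "real^'n^'n"
  assumes "orthogonal_matrix W"
  shows "W $ i $ j \<le> 1"
proof -
  have "norm (W $ i) = 1"
    using assms by (simp add: orthogonal_matrix_orthonormal_rows row_def)
  then show ?thesis
    using component_le_norm_cart[of "W $ i" j] by simp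
qed

lemma inner_orthogonal_le_inner_svd:
  fixes A U S V Q :: "real^'n^'n"
  assumes svd: "is_svd A U S V" and Q: "orthogonal_matrix Q"
  shows "Q \<bullet> A \<le> (U ** transpose V) \<bullet> A"
proof -
  from svd have U: "orthogonal_matrix U" and V: "orthogonal_matrix V"
    and diag: "\<And>i j. i \<noteq> j \<Longrightarrow> S $ i $ j = 0" and nonneg: "\<And>i. 0 \<le> S $ i $ i"
    and A: "A = U ** S ** transpose V"
    by (auto simp: is_svd_def)
  \<comment> \<open>Adjointness carries \<open>U\<close> and \<open>V\<close> over to
    \<open>R\<close>; against the diagonal \<open>S\<close> only diagonal entries survive.
    \<open>R\<close> stays general because both \<open>Q\<close> and the claimed maximizer are
    inserted below.\<close>
  have rotate: "R \<bullet> A = (\<Sum>i\<in>UNIV. (transpose U ** R ** V) $ i $ i * S $ i $ i)" for R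
  proof -
    have "R \<bullet> A = (transpose U ** R ** V) \<bullet> S"
      using inner_matrix_mult_left[of "transpose U" R "S ** transpose V"]
      by (simp add: A inner_matrix_mult_right matrix_mul_assoc)
    also have "\<dots> = (\<Sum>i\<in>UNIV. \<Sum>j\<in>UNIV.
        if j = i then (transpose U ** R ** V) $ i $ i * S $ i $ i else 0)"
      unfolding inner_vec_def by (intro sum.cong refl) (auto simp: diag)
    finally show ?thesis by simp
  qed
  have "orthogonal_matrix (transpose U ** Q ** V)"
    using U V Q by (intro orthogonal_matrix_mul) (simp_all add: orthogonal_matrix_transpose)
  \<comment> \<open>Multiplying the entry bound by \<open>S $ i $ i\<close> keeps its direction
    since singular values are nonnegative.\<close>
  then have "Q \<bullet> A \<le> (\<Sum>i\<in>UNIV. S $ i $ i)"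
    unfolding rotate
    by (intro sum_mono) (metis mult_1 mult_right_mono nonneg orthogonal_matrix_entry_le_1)
  also have "\<dots> = (U ** transpose V) \<bullet> A"
  proof -
    \<comment> \<open>At the claimed maximizer the rotated matrix is the identity, so the bound is
      attained.\<close>
    have "transpose U ** (U ** transpose V) ** V = (transpose U ** U) ** (transpose V ** V)"
      by (simp add: matrix_mul_assoc)
    also have "\<dots> = mat 1"
      using U V by (simp add: orthogonal_matrix)
    finally show ?thesis
      unfolding rotate by (simp add: mat_def)
  qed
  finally show ?thesis .
qed

text \<open>A weighted orthogonal Procrustes problem; the spatial and the temporal claim are both
  instances.\<close>

lemma weighted_procrustes:
  fixes \<Phi> :: "real^'q^'n" and \<Phi>s :: "'i \<Rightarrow> real^'q^'n" and w :: "'i \<Rightarrow> real"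
    and U S V :: "real^'q^'q"
  assumes \<Phi>: "orthonormal_columns \<Phi>"
    and svd: "is_svd (transpose \<Phi> ** (\<Sum>i\<in>I. w i *\<^sub>R \<Phi>s i)) U S V"
  shows "is_arg_min (\<lambda>Q. \<Sum>i\<in>I. w i * (frobenius_norm (\<Phi> ** Q - \<Phi>s i))\<^sup>2)
           orthogonal_matrix (U ** transpose V)"
proof -
  define A where "A = transpose \<Phi> ** (\<Sum>i\<in>I. w i *\<^sub>R \<Phi>s i)"
  \<comment> \<open>Collects the terms independent of \<open>Q\<close>; \<open>norm (mat 1)\<close>
    is the common value of \<open>norm (\<Phi> ** Q)\<close> over all orthogonal
    \<open>Q\<close>.\<close>
  define c where "c = (\<Sum>i\<in>I. w i * ((norm (mat 1 :: real^'q^'q))\<^sup>2 + (norm (\<Phi>s i))\<^sup>2))"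
  have objective: "(\<Sum>i\<in>I. w i * (frobenius_norm (\<Phi> ** Q - \<Phi>s i))\<^sup>2) = c - 2 * (Q \<bullet> A)"
    if Q: "orthogonal_matrix Q" for Q
  proof -
    have "(norm (\<Phi> ** Q - \<Phi>s i))\<^sup>2
        = (norm (mat 1 :: real^'q^'q))\<^sup>2 + (norm (\<Phi>s i))\<^sup>2 - 2 * ((\<Phi> ** Q) \<bullet> \<Phi>s i)" for i
      using norm_orthonormal_columns_mult[OF \<Phi>, of Q] norm_orthogonal_matrix_mat_1[OF Q]
      by (simp add: power2_norm_eq_inner inner_diff inner_commute norm_eq)
    \<comment> \<open>The cross terms are linear in \<open>\<Phi>s i\<close>, so the weighted sum
      moves inside a single inner product.\<close>
    then have "(\<Sum>i\<in>I. w i * (frobenius_norm (\<Phi> ** Q - \<Phi>s i))\<^sup>2)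
        = c - 2 * ((\<Phi> ** Q) \<bullet> (\<Sum>i\<in>I. w i *\<^sub>R \<Phi>s i))"
      by (simp add: frobenius_norm_eq_norm c_def inner_sum_right sum_distrib_left
          right_diff_distrib sum_subtractf mult_ac)
    then show ?thesis
      by (simp add: A_def inner_matrix_mult_left)
  qed
  have "orthogonal_matrix (U ** transpose V)"
    using svd by (auto simp: is_svd_def orthogonal_matrix_transpose intro: orthogonal_matrix_mul)
  \<comment> \<open>On the feasible set the objective is \<open>c - 2 * (Q \<bullet> A)\<close>, so
    a maximizer of the inner product is a minimizer.\<close>
  then show ?thesis
    using inner_orthogonal_le_inner_svd[OF svd]
    by (fastforce simp: is_arg_min_linorder objective A_def)
qed

theorem mainTheorem1:
  fixes N\<^sub>p :: nat
    and \<Phi> :: "real^'q^'x" and \<Phi>s :: "nat \<Rightarrow> real^'q^'x"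
    and \<Lambda> :: "real^'q^'s" and \<Lambda>s :: "nat \<Rightarrow> real^'q^'s"
    and m l :: real
    and \<omega> \<kappa> :: "nat \<Rightarrow> real"
    and \<xi> \<Theta> \<eta> \<zeta> \<delta> \<rho> :: "real^'q^'q"
  assumes "N\<^sub>p \<ge> 1"
    and "CARD('q) \<le> CARD('x)" and "CARD('q) \<le> CARD('s)"
    and "orthonormal_columns \<Phi>"
    and "\<And>i. i \<in> {1..N\<^sub>p} \<Longrightarrow> orthonormal_columns (\<Phi>s i)"
    and "orthonormal_columns \<Lambda>"
    and "\<And>i. i \<in> {1..N\<^sub>p} \<Longrightarrow> orthonormal_columns (\<Lambda>s i)"
    and "\<And>i. i \<in> {1..N\<^sub>p} \<Longrightarrow> grassmann_dist \<Phi> (\<Phi>s i) \<noteq> 0"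
    and "\<And>i. i \<in> {1..N\<^sub>p} \<Longrightarrow> grassmann_dist \<Lambda> (\<Lambda>s i) \<noteq> 0"
    and "m > 1" and "l \<ge> 1"
    and "\<And>i. i \<in> {1..N\<^sub>p} \<Longrightarrow>
           \<omega> i = grassmann_dist \<Phi> (\<Phi>s i) powr (- m) /
                 (\<Sum>k=1..N\<^sub>p. grassmann_dist \<Phi> (\<Phi>s k) powr (- m))"
    and "\<And>i. i \<in> {1..N\<^sub>p} \<Longrightarrow>
           \<kappa> i = grassmann_dist \<Lambda> (\<Lambda>s i) powr (- l) /
                 (\<Sum>k=1..N\<^sub>p. grassmann_dist \<Lambda> (\<Lambda>s k) powr (- l))"
    and "is_svd (transpose \<Phi> ** (\<Sum>i=1..N\<^sub>p. \<omega> i *\<^sub>R \<Phi>s i)) \<xi> \<Theta> \<eta>"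
    and "is_svd (transpose \<Lambda> ** (\<Sum>i=1..N\<^sub>p. \<kappa> i *\<^sub>R \<Lambda>s i)) \<zeta> \<delta> \<rho>"
  shows "is_arg_min (\<lambda>Q. \<Sum>i=1..N\<^sub>p. \<omega> i * (frobenius_norm (\<Phi> ** Q - \<Phi>s i))\<^sup>2)
           orthogonal_matrix (\<xi> ** transpose \<eta>) \<and>
         is_arg_min (\<lambda>Q. \<Sum>i=1..N\<^sub>p. \<kappa> i * (frobenius_norm (\<Lambda> ** Q - \<Lambda>s i))\<^sup>2)
           orthogonal_matrix (\<zeta> ** transpose \<rho>)"
  using assms by (intro conjI weighted_procrustes)

end
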